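(* Let $T$ be an $n\times n$ sub-stochastic matrix. Then for any $n\times n$ stochastic matrix $S$: (a) $\|T-\mathrm{dnf}(T)\|_\infty\le\|T-S\|_\infty$; (b) $\|T-\mathrm{dnf}(T)\|_2\le\|T-S\|_2$; (c) $\|T-\mathrm{dnf}(T)\|_{\mathrm F}\le\|T-S\|_{\mathrm F}$.
   Context: All matrices are real. A matrix in $\mathbb{R}^{n\times n}$ with nonnegative entries is stochastic if each row sums to $1$, and sub-stochastic if each row sums to at most $1$. The dangling node fix of an $n\times n$ sub-stochastic matrix $T$ is $\mathrm{dnf}(T):=T+\frac1n(J-TJ)$, where $J$ is the $n\times n$ all-ones matrix. $\|\cdot\|_\infty$ and $\|\cdot\|_2$ are the matrix norms induced by the $\ell_\infty$ and $\ell_2$ vector norms (maximum absolute row sum and largest singular value, respectively); $\|\cdot\|_{\mathrm F}$ is the Frobenius norm. *)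

theory Defs
  imports "HOL-Analysis.Analysis"
begin

definition stochastic :: "real^'n^'n \<Rightarrow> bool" where
  "stochastic A \<longleftrightarrow> (\<forall>i j. 0 \<le> A $ i $ j) \<and> (\<forall>i. (\<Sum>j\<in>UNIV. A $ i $ j) = 1)"

definition sub_stochastic :: "real^'n^'n \<Rightarrow> bool" where
  "sub_stochastic A \<longleftrightarrow> (\<forall>i j. 0 \<le> A $ i $ j) \<and> (\<forall>i. (\<Sum>j\<in>UNIV. A $ i $ j) \<le> 1)"

definition all_ones :: "real^'n^'n" where
  "all_ones = (\<chi> i j. 1)"

definition dnf :: "real^'n^'n \<Rightarrow> real^'n^'n" where
  "dnf T = T + (1 / real CARD('n)) *\<^sub>R (all_ones - T ** all_ones)"

text \<open>The vector \<open>x = 0\<close> contributes \<open>0 / 0 = 0\<close> to the supremum, as in the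
  library's \<^const>\<open>onorm\<close>.\<close>

definition mat_norm_inf :: "real^'n^'m \<Rightarrow> real" where
  "mat_norm_inf A = (SUP x. infnorm (A *v x) / infnorm x)"

text \<open>The library norm on \<open>real^'n\<close> is the Euclidean one, so \<^const>\<open>onorm\<close> is the
  operator norm induced by the \<open>\<ell>\<^sub>2\<close> vector norm.\<close>

definition mat_norm_2 :: "real^'n^'m \<Rightarrow> real" where
  "mat_norm_2 A = onorm (\<lambda>x. A *v x)"

definition mat_norm_F :: "real^'n^'m \<Rightarrow> real" where
  "mat_norm_F A = sqrt (\<Sum>i\<in>UNIV. \<Sum>j\<in>UNIV. (A $ i $ j)\<^sup>2)"

lemma infnorm_le_cart:
  fixes x :: "real^'n"
  assumes "\<And>i. \<bar>x $ i\<bar> \<le> c"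
  shows "infnorm x \<le> c"
  unfolding infnorm_cart by (rule cSup_least) (use assms in auto)

lemma mat_norm_inf_eq_max_row_sum:
  fixes A :: "real^'n^'m"
  shows "mat_norm_inf A = (MAX i. \<Sum>j\<in>UNIV. \<bar>A $ i $ j\<bar>)"
proof -
  let ?r = "\<lambda>i. \<Sum>j\<in>UNIV. \<bar>A $ i $ j\<bar>"
  let ?M = "MAX i. ?r i"
  have r_le: "?r i \<le> ?M" for i
    by (intro Max_ge) auto
  have M0: "0 \<le> ?M"
    using r_le order_trans sum_nonneg by (metis (no_types, lifting) abs_ge_zero)
  have bound: "infnorm (A *v x) / infnorm x \<le> ?M" for x
  proof (cases "x = 0")
    case True
    then show ?thesis using M0 by (simp add: infnorm_0)
  next
    case False
    have "infnorm (A *v x) \<le> ?M * infnorm x"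
    proof (rule infnorm_le_cart)
      fix i
      have "\<bar>(A *v x) $ i\<bar> \<le> (\<Sum>j\<in>UNIV. \<bar>A $ i $ j * x $ j\<bar>)"
        by (simp add: matrix_vector_mult_def)
      also have "\<dots> \<le> (\<Sum>j\<in>UNIV. \<bar>A $ i $ j\<bar> * infnorm x)"
        by (intro sum_mono) (simp add: abs_mult component_le_infnorm_cart mult_left_mono)
      also have "\<dots> = ?r i * infnorm x"
        by (simp add: sum_distrib_right)
      also have "\<dots> \<le> ?M * infnorm x"
        by (intro mult_right_mono r_le infnorm_pos_le)
      finally show "\<bar>(A *v x) $ i\<bar> \<le> ?M * infnorm x" .
    qed
    then show ?thesis
      using False by (simp add: divide_le_eq infnorm_pos_lt)
  qed
  have bdd: "bdd_above (range (\<lambda>x. infnorm (A *v x) / infnorm x))"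
    using bound by (intro bdd_aboveI[of _ ?M]) auto
  have "?r i \<le> mat_norm_inf A" for i
  proof -
    define x :: "real^'n" where "x = (\<chi> j. if A $ i $ j < 0 then -1 else 1)"
    have "infnorm x \<le> 1"
      by (rule infnorm_le_cart) (simp add: x_def)
    moreover have "1 \<le> infnorm x"
      using component_le_infnorm_cart[of x undefined] by (simp add: x_def split: if_splits)
    ultimately have x1: "infnorm x = 1" by simp
    have "?r i = (A *v x) $ i"
      unfolding matrix_vector_mult_def x_def by (auto intro!: sum.cong)
    also have "\<dots> \<le> infnorm (A *v x) / infnorm x"
      using component_le_infnorm_cart[of "A *v x" i] by (simp add: x1)
    also have "\<dots> \<le> mat_norm_inf A"
      unfolding mat_norm_inf_def by (rule cSUP_upper[OF UNIV_I bdd])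
    finally show ?thesis .
  qed
  then have "?M \<le> mat_norm_inf A" by (subst Max_le_iff) auto
  moreover have "mat_norm_inf A \<le> ?M"
    unfolding mat_norm_inf_def using bound by (intro cSUP_least) auto
  ultimately show ?thesis by (rule antisym[rotated])
qed

lemma mat_norm_F_eq_norm: "mat_norm_F A = norm A"
  by (simp add: mat_norm_F_def norm_vec_def L2_set_def sum_nonneg)

end

theory Submission
  imports Defs
begin

text \<open>
  Let \<open>P = J / n\<close> be the orthogonal projection onto the constant vectors. Since \<open>S\<close> has
  row sums \<open>1\<close>, \<open>T - dnf T = (T - S) P\<close>, and multiplication by \<open>P\<close> on the right does
  not increase any of the three norms.
\<close>

definition averaging :: "real^'n^'n" where
  "averaging = (1 / real CARD('n)) *\<^sub>R all_ones"

lemma matrix_mult_averaging_nth: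
  fixes A :: "real^'n^'m"
  shows "(A ** averaging) $ i $ j = (\<Sum>k\<in>UNIV. A $ i $ k) / real CARD('n)"
  by (simp add: averaging_def all_ones_def matrix_matrix_mult_def sum_divide_distrib)

lemma averaging_vector_mult_nth:
  fixes x :: "real^'n"
  shows "(averaging *v x) $ i = (\<Sum>k\<in>UNIV. x $ k) / real CARD('n)"
  by (simp add: averaging_def all_ones_def matrix_vector_mult_def sum_divide_distrib)

text \<open>Holds because \<open>averaging\<close> is symmetric. It reduces the Frobenius bound to a
  bound on single rows.\<close>

lemma row_matrix_mult_averaging: "(A ** averaging) $ i = averaging *v (A $ i)"
  by (simp add: vec_eq_iff matrix_mult_averaging_nth averaging_vector_mult_nth)

text \<open>\<open>S\<close> enters the right-hand side only through its row sums, so row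
  \<open>i\<close> of either side is constant with entry (row sum of \<open>T\<close> minus 1) /
  n.\<close>

lemma minus_dnf_eq_mult_averaging:
  fixes T S :: "real^'n^'n"
  assumes "stochastic S"
  shows "T - dnf T = (T - S) ** averaging"
proof -
  have "(T - dnf T) $ i $ j = ((T - S) ** averaging) $ i $ j" for i j
  proof -
    have "(\<Sum>k\<in>UNIV. S $ i $ k) = 1"
      using assms by (simp add: stochastic_def)
    then have "((T - S) ** averaging) $ i $ j = ((\<Sum>k\<in>UNIV. T $ i $ k) - 1) / real CARD('n)"
      unfolding matrix_mult_averaging_nth by (simp add: sum_subtractf)
    then show ?thesis
      by (simp add: dnf_def matrix_matrix_mult_def all_ones_def diff_divide_distrib)
  qed
  then show ?thesis
    by (simp add: vec_eq_iff)
qed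

lemma norm_averaging_vector_mult_le:
  fixes x :: "real^'n"
  shows "norm (averaging *v x) \<le> norm x"
proof -
  let ?n = "real CARD('n)" and ?s = "\<Sum>k\<in>UNIV. x $ k"
  have "norm (averaging *v x) = sqrt (?n * (?s / ?n)\<^sup>2)"
    by (simp add: norm_vec_def L2_set_def averaging_vector_mult_nth power_divide)
  also have "?n * (?s / ?n)\<^sup>2 = ?s\<^sup>2 / ?n"
    by (simp add: power2_eq_square)
  \<comment> \<open>Cauchy-Schwarz against the all-ones vector.\<close>
  also have "?s\<^sup>2 / ?n \<le> (\<Sum>k\<in>UNIV. (x $ k)\<^sup>2)"
    using sum_squared_le_sum_of_squares[of "\<lambda>k. x $ k" UNIV]
    by (simp add: divide_le_eq mult.commute)
  also have "sqrt (\<Sum>k\<in>UNIV. (x $ k)\<^sup>2) = norm x"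
    by (simp add: norm_vec_def L2_set_def)
  finally show ?thesis by simp
qed

text \<open>The n equal entries of a row of the product have absolute values adding up to the
  absolute value of that row sum of \<open>A\<close>; the triangle inequality does the rest.\<close>

lemma mat_norm_inf_mult_averaging_le:
  fixes A :: "real^'n^'m"
  shows "mat_norm_inf (A ** averaging) \<le> mat_norm_inf A"
proof -
  have "(\<Sum>j\<in>UNIV. \<bar>(A ** averaging) $ i $ j\<bar>) \<le> (\<Sum>j\<in>UNIV. \<bar>A $ i $ j\<bar>)" for i
    by (simp add: matrix_mult_averaging_nth abs_divide)
  also have "(\<Sum>j\<in>UNIV. \<bar>A $ i $ j\<bar>) \<le> mat_norm_inf A" for i
    unfolding mat_norm_inf_eq_max_row_sum by (intro Max_ge) auto
  finally show ?thesis
    by (subst mat_norm_inf_eq_max_row_sum) auto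
qed

text \<open>Apply \<open>averaging\<close> first: it does not lengthen \<open>x\<close>, and
  \<open>A\<close> then stretches by at most its operator norm.\<close>

lemma mat_norm_2_mult_averaging_le:
  fixes A :: "real^'n^'m"
  shows "mat_norm_2 (A ** averaging) \<le> mat_norm_2 A"
  unfolding mat_norm_2_def
proof (rule onorm_le)
  fix x :: "real^'n"
  have bl: "bounded_linear (\<lambda>x. A *v x)"
    by (rule matrix_vector_mul_bounded_linear)
  have "norm ((A ** averaging) *v x) = norm (A *v (averaging *v x))"
    by (simp add: matrix_vector_mul_assoc)
  also have "\<dots> \<le> onorm (\<lambda>x. A *v x) * norm (averaging *v x)"
    by (rule onorm[OF bl])
  also have "\<dots> \<le> onorm (\<lambda>x. A *v x) * norm x"
    by (intro mult_left_mono norm_averaging_vector_mult_le onorm_pos_le[OF bl])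
  finally show "norm ((A ** averaging) *v x) \<le> onorm (\<lambda>x. A *v x) * norm x" .
qed

text \<open>The Frobenius norm is the Euclidean norm of the vector of row norms, so it suffices that
  no row gets longer.\<close>

lemma mat_norm_F_mult_averaging_le:
  fixes A :: "real^'n^'m"
  shows "mat_norm_F (A ** averaging) \<le> mat_norm_F A"
  unfolding mat_norm_F_eq_norm
  by (rule norm_le_componentwise_cart)
    (simp add: row_matrix_mult_averaging norm_averaging_vector_mult_le)

theorem proposition2p28:
  fixes T S :: "real^'n^'n"
  assumes "sub_stochastic T" and "stochastic S"
  shows "mat_norm_inf (T - dnf T) \<le> mat_norm_inf (T - S) \<and>
    mat_norm_2 (T - dnf T) \<le> mat_norm_2 (T - S) \<and>
    mat_norm_F (T - dnf T) \<le> mat_norm_F (T - S)"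
  unfolding minus_dnf_eq_mult_averaging[OF assms(2)]
  by (intro conjI mat_norm_inf_mult_averaging_le mat_norm_2_mult_averaging_le
      mat_norm_F_mult_averaging_le)

end
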